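(* Let $S,A$ be nonempty finite sets. Every deterministic policy $\pi\in S\triangleright A$ is specifiable: there exists a teleo-environment $\varepsilon\in A\triangleright(S\times G)$ such that for every policy $\pi'\in S\triangleright A$, $\mathcal{S}(\pi',\varepsilon)\ge\mathcal{S}(\pi,\varepsilon)$ implies $\pi'=\pi$.
   Context: For a finite set $X$, $P(X)$ is the set of probability distributions on $X$ and $\mathrm{supp}(p)$ is the support of $p\in P(X)$. For finite sets $I$ (inputs) and $O$ (outputs), the set $I \triangleright O$ of transducers is defined coinductively (it is the final coalgebra of $X \mapsto \sum_{p \in P(O)} (I \times \mathrm{supp}(p) \to X)$): a transducer $\pi$ is a pair $(\mathbb{P}_\pi, \mathbb{T}_\pi)$ with $\mathbb{P}_\pi \in P(O)$ and $\mathbb{T}_\pi : I \times \mathrm{supp}(\mathbb{P}_\pi) \to I \triangleright O$. Deterministic transducers are defined coinductively: $\pi$ is deterministic if $\mathbb{P}_\pi$ is a one-point distribution and $\mathbb{T}_\pi$ takes values in deterministic transducers. Let $G = \{\bot,\top\}$ ($\top$ = success). A policy is an element of $S\triangleright A$; a teleo-environment is an element of $A \triangleright (S\times G)$. The success probability $\mathcal{S}(\pi,\varepsilon)$ (the probability that $\top$ is emitted at least once when $\pi$ and $\varepsilon$ are coupled) is $\lim_{n\to\infty} \mathcal{S}_n(\pi,\varepsilon)$, where $\mathcal{S}_0(\pi,\varepsilon) = \sum_{s\in S} \mathbb{P}_\varepsilon(s,\top)$ and $\mathcal{S}_{n+1}(\pi,\varepsilon) = \sum_{s\in S}\sum_{a\in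 A} \left[\mathbb{P}_\pi(a)\mathbb{P}_\varepsilon(s,\top) + \mathbb{P}_\pi(a)\mathbb{P}_\varepsilon(s,\bot)\, \mathcal{S}_n\big(\mathbb{T}_\pi(s,a), \mathbb{T}_\varepsilon(a,(s,\bot))\big)\right]$ (terms with zero coefficient are omitted). *)

theory Defs
  imports "HOL-Probability.Probability"
begin

(* A function on I \<times> supp p is encoded as a partial function on the whole of
   'i \<times> 'o whose domain is UNIV \<times> set_pmf p. The codatatype does not enforce this
   domain; the transducers are the states from which it holds hereditarily. Because the
   partial function is undefined off the support, equality of transducers is equality in
   the final coalgebra (see lemma transducer_final). *)
codatatype ('i, 'o) pretransducer =
  Pretransducer (pre_emit: "'o pmf") (pre_trans: "'i \<times> 'o \<Rightarrow> ('i, 'o) pretransducer option")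

coinductive wf_pretransducer :: "('i, 'o) pretransducer \<Rightarrow> bool" where
  "\<lbrakk>dom (pre_trans t) = UNIV \<times> set_pmf (pre_emit t);
    \<And>z u. pre_trans t z = Some u \<Longrightarrow> wf_pretransducer u\<rbrakk> \<Longrightarrow> wf_pretransducer t"

primcorec unfold_pre ::
    "('x \<Rightarrow> 'o pmf) \<Rightarrow> ('x \<Rightarrow> 'i \<times> 'o \<Rightarrow> 'x) \<Rightarrow> 'x \<Rightarrow> ('i, 'o) pretransducer" where
  "pre_emit (unfold_pre p f x) = p x"
| "pre_trans (unfold_pre p f x) =
    (\<lambda>z. map_option (unfold_pre p f) (if snd z \<in> set_pmf (p x) then Some (f x z) else None))"

lemma wf_unfold_pre: "wf_pretransducer (unfold_pre p f x)"
proof (coinduction arbitrary: x rule: wf_pretransducer.coinduct)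
  case wf_pretransducer
  show ?case by (auto simp: dom_def split: if_splits)
qed

typedef ('i, 'o) transducer = "{t :: ('i, 'o) pretransducer. wf_pretransducer t}"
  morphisms Rep_transducer Abs_transducer
  using wf_unfold_pre[of "\<lambda>_. return_pmf undefined" "\<lambda>_ _. ()" "()"] by blast

definition emit :: "('i, 'o) transducer \<Rightarrow> 'o pmf" where
  "emit \<pi> = pre_emit (Rep_transducer \<pi>)"

(* Meaningful only for pairs (i, y) with y \<in> set_pmf (emit \<pi>). *)
definition transition :: "('i, 'o) transducer \<Rightarrow> 'i \<times> 'o \<Rightarrow> ('i, 'o) transducer" where
  "transition \<pi> z = Abs_transducer (the (pre_trans (Rep_transducer \<pi>) z))"

lemma pre_trans_Rep:
  "pre_trans (Rep_transducer \<pi>) (i, y) =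
    (if y \<in> set_pmf (emit \<pi>) then Some (Rep_transducer (transition \<pi> (i, y))) else None)"
proof -
  have wf: "wf_pretransducer (Rep_transducer \<pi>)"
    using Rep_transducer by blast
  then have dom: "dom (pre_trans (Rep_transducer \<pi>)) = UNIV \<times> set_pmf (emit \<pi>)"
    by (cases rule: wf_pretransducer.cases) (simp add: emit_def)
  show ?thesis
  proof (cases "y \<in> set_pmf (emit \<pi>)")
    case True
    then have "(i, y) \<in> dom (pre_trans (Rep_transducer \<pi>))"
      using dom by simp
    then obtain u where u: "pre_trans (Rep_transducer \<pi>) (i, y) = Some u"
      by blast
    with wf have "wf_pretransducer u"
      by (cases rule: wf_pretransducer.cases) blast
    with u True show ?thesis
      by (simp add: transition_def Abs_transducer_inverse)
  next
    case False
    then show ?thesis using dom by (auto simp: dom_def)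
  qed
qed

lemma transducer_coinduct:
  assumes "R \<pi> \<rho>"
    and step: "\<And>\<pi> \<rho>. R \<pi> \<rho> \<Longrightarrow> emit \<pi> = emit \<rho> \<and>
      (\<forall>i. \<forall>y \<in> set_pmf (emit \<pi>). R (transition \<pi> (i, y)) (transition \<rho> (i, y)))"
  shows "\<pi> = \<rho>"
proof -
  have "Rep_transducer \<pi> = Rep_transducer \<rho>"
    using assms(1)
  proof (coinduction arbitrary: \<pi> \<rho> rule: pretransducer.coinduct)
    case Eq_pretransducer
    note st = step[OF Eq_pretransducer]
    have "rel_option
        (\<lambda>t u. \<exists>\<pi> \<rho>. t = Rep_transducer \<pi> \<and> u = Rep_transducer \<rho> \<and> R \<pi> \<rho>)
        (pre_trans (Rep_transducer \<pi>) (i, y)) (pre_trans (Rep_transducer \<rho>) (i, y))" for i y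
    proof (cases "y \<in> set_pmf (emit \<pi>)")
      case True
      with st have "R (transition \<pi> (i, y)) (transition \<rho> (i, y))"
        and "y \<in> set_pmf (emit \<rho>)" by auto
      with True show ?thesis
        unfolding pre_trans_Rep by (auto simp only: if_True option.rel_inject)
    next
      case False
      with st have "y \<notin> set_pmf (emit \<rho>)" by simp
      with False show ?thesis by (simp add: pre_trans_Rep)
    qed
    then show ?case
      using step[OF Eq_pretransducer] by (auto simp: emit_def rel_fun_def)
  qed
  then show ?thesis by (simp add: Rep_transducer_inject)
qed

lemma transducer_final:
  fixes p :: "'x \<Rightarrow> 'o pmf" and f :: "'x \<Rightarrow> 'i \<times> 'o \<Rightarrow> 'x"
  shows "\<exists>!h :: 'x \<Rightarrow> ('i, 'o) transducer. \<forall>x. emit (h x) = p x \<and>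
    (\<forall>i. \<forall>y \<in> set_pmf (p x). transition (h x) (i, y) = h (f x (i, y)))"
proof (rule ex_ex1I)
  define h :: "'x \<Rightarrow> ('i, 'o) transducer" where "h x = Abs_transducer (unfold_pre p f x)" for x
  have "Rep_transducer (h x) = unfold_pre p f x" for x
    by (simp add: h_def Abs_transducer_inverse wf_unfold_pre)
  then have "\<forall>x. emit (h x) = p x \<and>
      (\<forall>i. \<forall>y \<in> set_pmf (p x). transition (h x) (i, y) = h (f x (i, y)))"
    by (simp add: emit_def transition_def h_def)
  then show "\<exists>h :: 'x \<Rightarrow> ('i, 'o) transducer. \<forall>x. emit (h x) = p x \<and>
      (\<forall>i. \<forall>y \<in> set_pmf (p x). transition (h x) (i, y) = h (f x (i, y)))" by blast
next
  fix h k :: "'x \<Rightarrow> ('i, 'o) transducer"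
  assume hk: "\<forall>x. emit (h x) = p x \<and>
      (\<forall>i. \<forall>y \<in> set_pmf (p x). transition (h x) (i, y) = h (f x (i, y)))"
    "\<forall>x. emit (k x) = p x \<and>
      (\<forall>i. \<forall>y \<in> set_pmf (p x). transition (k x) (i, y) = k (f x (i, y)))"
  have "h x = k x" for x
    by (rule transducer_coinduct[where R = "\<lambda>\<pi> \<rho>. \<exists>x. \<pi> = h x \<and> \<rho> = k x"])
      (use hk in auto)
  then show "h = k" by blast
qed

coinductive deterministic :: "('i, 'o) transducer \<Rightarrow> bool" where
  "\<lbrakk>\<exists>y. emit \<pi> = return_pmf y;
    \<And>i y. y \<in> set_pmf (emit \<pi>) \<Longrightarrow> deterministic (transition \<pi> (i, y))\<rbrakk> \<Longrightarrow> deterministic \<pi>"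

type_synonym ('s, 'a) policy = "('s, 'a) transducer"

(* True is \<top> (success), False is \<bottom>. *)
type_synonym ('s, 'a) teleo_environment = "('a, 's \<times> bool) transducer"

(* The arguments given to transition lie outside the support only in terms whose coefficient
   is 0. *)
primrec success_upto ::
    "nat \<Rightarrow> ('s::finite, 'a::finite) policy \<Rightarrow> ('s, 'a) teleo_environment \<Rightarrow> real" where
  "success_upto 0 \<pi> \<epsilon> = (\<Sum>s\<in>UNIV. pmf (emit \<epsilon>) (s, True))"
| "success_upto (Suc n) \<pi> \<epsilon> = (\<Sum>s\<in>UNIV. \<Sum>a\<in>UNIV.
      pmf (emit \<pi>) a * pmf (emit \<epsilon>) (s, True) +
      pmf (emit \<pi>) a * pmf (emit \<epsilon>) (s, False) *
        success_upto n (transition \<pi> (s, a)) (transition \<epsilon> (a, (s, False))))"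

definition success ::
    "('s::finite, 'a::finite) policy \<Rightarrow> ('s, 'a) teleo_environment \<Rightarrow> real" where
  "success \<pi> \<epsilon> = lim (\<lambda>n. success_upto n \<pi> \<epsilon>)"

lemma sum_pmf_UNIV: "(\<Sum>x\<in>UNIV. pmf p (x :: 'x::finite)) = 1"
  by (rule sum_pmf_eq_1) auto

lemma sum_pmf_success_failure:
  "(\<Sum>s\<in>UNIV. pmf p (s :: 's::finite, True) + pmf p (s, False)) = 1"
proof -
  have "(\<Sum>s\<in>UNIV. \<Sum>g\<in>UNIV. pmf p (s, g :: bool)) = (\<Sum>z\<in>UNIV. pmf p z)"
    by (simp add: sum.cartesian_product del: UNIV_bool)
  then show ?thesis by (simp add: UNIV_bool sum_pmf_UNIV add.commute)
qed

lemma success_upto_nonneg: "0 \<le> success_upto n \<pi> \<epsilon>"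
  by (induction n arbitrary: \<pi> \<epsilon>) (auto intro!: sum_nonneg add_nonneg_nonneg mult_nonneg_nonneg)

lemma success_upto_le_1: "success_upto n \<pi> \<epsilon> \<le> 1"
proof (induction n arbitrary: \<pi> \<epsilon>)
  case 0
  have "success_upto 0 \<pi> \<epsilon> \<le> (\<Sum>s\<in>UNIV. pmf (emit \<epsilon>) (s, True) + pmf (emit \<epsilon>) (s, False))"
    by (auto intro!: sum_mono)
  then show ?case by (simp only: sum_pmf_success_failure)
next
  case (Suc n)
  have "success_upto (Suc n) \<pi> \<epsilon> \<le> (\<Sum>s\<in>UNIV. \<Sum>a\<in>UNIV.
      pmf (emit \<pi>) a * (pmf (emit \<epsilon>) (s, True) + pmf (emit \<epsilon>) (s, False)))"
    unfolding success_upto.simps distrib_left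
    by (intro sum_mono add_left_mono mult_left_le Suc mult_nonneg_nonneg pmf_nonneg)
  then show ?case
    by (simp only: sum_distrib_right[symmetric] sum_pmf_UNIV mult_1_left sum_pmf_success_failure)
qed

lemma success_upto_Suc: "success_upto n \<pi> \<epsilon> \<le> success_upto (Suc n) \<pi> \<epsilon>"
proof (induction n arbitrary: \<pi> \<epsilon>)
  case 0
  have "success_upto 0 \<pi> \<epsilon> = (\<Sum>s\<in>UNIV. \<Sum>a\<in>UNIV. pmf (emit \<pi>) a * pmf (emit \<epsilon>) (s, True))"
    by (simp add: sum_distrib_right[symmetric] sum_pmf_UNIV)
  also have "\<dots> \<le> success_upto (Suc 0) \<pi> \<epsilon>"
    unfolding success_upto.simps(2)
    by (intro sum_mono) (simp add: success_upto_nonneg del: success_upto.simps)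
  finally show ?case .
next
  case (Suc n)
  show ?case
    unfolding success_upto.simps(2)
    by (intro sum_mono add_left_mono mult_left_mono Suc[unfolded success_upto.simps(2)] mult_nonneg_nonneg pmf_nonneg)
qed

lemma success_upto_tendsto: "(\<lambda>n. success_upto n \<pi> \<epsilon>) \<longlonglongrightarrow> success \<pi> \<epsilon>"
proof -
  have "incseq (\<lambda>n. success_upto n \<pi> \<epsilon>)"
    by (rule incseq_SucI) (rule success_upto_Suc)
  then obtain L where "(\<lambda>n. success_upto n \<pi> \<epsilon>) \<longlonglongrightarrow> L"
    by (rule incseq_convergent[where B = 1]) (use success_upto_le_1 in blast)
  then show ?thesis by (simp add: success_def limI)
qed

definition specifiable :: "('s::finite, 'a::finite) policy \<Rightarrow> bool" where
  "specifiable \<pi> \<longleftrightarrow> (\<exists>\<epsilon> :: ('s, 'a) teleo_environment. \<forall>\<pi>' :: ('s, 'a) policy.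
      success \<pi>' \<epsilon> \<ge> success \<pi> \<epsilon> \<longrightarrow> \<pi>' = \<pi>)"

end

(* The environment shadows \<pi>. As long as the actions agree with \<pi> it emits a uniformly
   distributed pair (s, g), so every step succeeds with probability 1/2 and every observation
   occurs together with a failure; after the first deviation it never succeeds again. Hence \<pi>
   succeeds almost surely, whereas a policy that can deviate from \<pi> reaches the losing state
   with positive probability before any success. *)
theory Submission
  imports Defs
begin

text \<open>Passing to the complement cancels the \<open>True\<close> terms, because the joint
  weights of actions and emissions sum to 1. What remains is a recursion with nonnegative terms
  only.\<close>

lemma one_minus_success_upto_Suc:
  "1 - success_upto (Suc n) \<pi> \<epsilon> = (\<Sum>s\<in>UNIV. \<Sum>a\<in>UNIV.
    pmf (emit \<pi>) a * pmf (emit \<epsilon>) (s, False) *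
      (1 - success_upto n (transition \<pi> (s, a)) (transition \<epsilon> (a, (s, False)))))"
proof -
  have "1 = (\<Sum>s\<in>UNIV. \<Sum>a\<in>UNIV.
      pmf (emit \<pi>) a * (pmf (emit \<epsilon>) (s, True) + pmf (emit \<epsilon>) (s, False)))"
    by (simp only: sum_distrib_right[symmetric] sum_pmf_UNIV mult_1_left sum_pmf_success_failure)
  then have "1 - success_upto (Suc n) \<pi> \<epsilon> = (\<Sum>s\<in>UNIV. \<Sum>a\<in>UNIV.
      pmf (emit \<pi>) a * (pmf (emit \<epsilon>) (s, True) + pmf (emit \<epsilon>) (s, False))) -
      success_upto (Suc n) \<pi> \<epsilon>" by (rule arg_cong)
  then show ?thesis
    by (simp add: sum_subtractf[symmetric] algebra_simps)
qed

lemma one_minus_success: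
  "1 - success \<pi> \<epsilon> = (\<Sum>s\<in>UNIV. \<Sum>a\<in>UNIV.
    pmf (emit \<pi>) a * pmf (emit \<epsilon>) (s, False) *
      (1 - success (transition \<pi> (s, a)) (transition \<epsilon> (a, (s, False)))))"
proof (rule LIMSEQ_unique)
  show "(\<lambda>n. 1 - success_upto (Suc n) \<pi> \<epsilon>) \<longlonglongrightarrow> 1 - success \<pi> \<epsilon>"
    by (intro tendsto_intros LIMSEQ_Suc success_upto_tendsto)
  show "(\<lambda>n. 1 - success_upto (Suc n) \<pi> \<epsilon>) \<longlonglongrightarrow> (\<Sum>s\<in>UNIV. \<Sum>a\<in>UNIV.
      pmf (emit \<pi>) a * pmf (emit \<epsilon>) (s, False) *
        (1 - success (transition \<pi> (s, a)) (transition \<epsilon> (a, (s, False)))))"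
    unfolding one_minus_success_upto_Suc by (intro tendsto_intros success_upto_tendsto)
qed

lemma success_le_1: "success \<pi> \<epsilon> \<le> 1"
  using success_upto_tendsto by (rule LIMSEQ_le_const2) (use success_upto_le_1 in blast)

text \<open>A sum of nonnegative terms vanishes only termwise, so almost sure success is inherited
  along every failing step of positive probability.\<close>

lemma success_transition_eq_1:
  assumes "success \<pi> \<epsilon> = 1" and "a \<in> set_pmf (emit \<pi>)" and "(s, False) \<in> set_pmf (emit \<epsilon>)"
  shows "success (transition \<pi> (s, a)) (transition \<epsilon> (a, (s, False))) = 1"
proof -
  let ?t = "\<lambda>s a. pmf (emit \<pi>) a * pmf (emit \<epsilon>) (s, False) *
      (1 - success (transition \<pi> (s, a)) (transition \<epsilon> (a, (s, False))))"
  have nonneg: "0 \<le> ?t s a" for s a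
    by (simp add: success_le_1)
  have "(\<Sum>s\<in>UNIV. \<Sum>a\<in>UNIV. ?t s a) = 0"
    using assms(1) one_minus_success[of \<pi> \<epsilon>] by simp
  then have "?t s a = 0"
    using nonneg by (simp add: sum_nonneg_eq_0_iff sum_nonneg del: mult_eq_0_iff)
  with assms(2,3) show ?thesis by (simp add: set_pmf_iff)
qed

definition losing_env :: "('s, 'a) teleo_environment \<Rightarrow> bool" where
  "losing_env \<epsilon> \<longleftrightarrow> (\<exists>s. emit \<epsilon> = return_pmf (s, False)) \<and>
    (\<forall>a. \<forall>z \<in> set_pmf (emit \<epsilon>). transition \<epsilon> (a, z) = \<epsilon>)"

lemma success_losing_env:
  assumes "losing_env \<epsilon>"
  shows "success \<pi> \<epsilon> = 0"
proof -
  obtain s where s: "emit \<epsilon> = return_pmf (s, False)" and tr: "transition \<epsilon> (a, s, False) = \<epsilon>" for a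
    using assms by (auto simp: losing_env_def)
  have upto: "success_upto n \<rho> \<epsilon> = 0" for n \<rho>
  proof (induction n arbitrary: \<rho>)
    case (Suc n)
    \<comment> \<open>The product is treated as a whole: for \<open>s' = s\<close> the environment
      loops to itself, and for any other \<open>s'\<close> the transition is unspecified but its
      coefficient is 0.\<close>
    have "pmf (emit \<epsilon>) (s', False) * success_upto n \<rho>' (transition \<epsilon> (a, s', False)) = 0" for s' a \<rho>'
      by (cases "s' = s") (simp_all add: s tr Suc)
    moreover have "pmf (emit \<epsilon>) (s', True) = 0" for s'
      by (simp add: s)
    ultimately show ?case
      unfolding success_upto.simps by (simp only: mult.assoc mult_zero_right add_0 sum.neutral_const)
  qed (simp add: s)
  then show ?thesis
    using success_upto_tendsto[of \<pi> \<epsilon>] by (simp add: LIMSEQ_const_iff)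
qed

lemma deterministicD:
  assumes "deterministic \<pi>"
  shows "\<exists>a. emit \<pi> = return_pmf a \<and> (\<forall>s. deterministic (transition \<pi> (s, a)))"
  using assms by (cases rule: deterministic.cases) auto

text \<open>\<open>h\<close> unfolds the shadowing environment: its state is
  \<open>Some \<rho>\<close> while the remaining policy to be matched is \<rho>, and
  \<open>None\<close> after a deviation.\<close>

context
  fixes h :: "('s::finite, 'a::finite) policy option \<Rightarrow> ('s, 'a) teleo_environment"
  assumes emit_on_track: "emit (h (Some \<rho>)) = pmf_of_set UNIV"
    and transition_on_track: "transition (h (Some \<rho>)) (a, (s, g)) =
      h (if emit \<rho> = return_pmf a then Some (transition \<rho> (s, a)) else None)"
    and losing_off_track: "losing_env (h None)"
begin

text \<open>Each emission fails with probability 1/2 and \<rho> never leaves the track. The exponent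
  is \<open>Suc n\<close> because \<open>success_upto n\<close> covers n + 1 emissions.\<close>

lemma one_minus_success_upto_on_track:
  "deterministic \<rho> \<Longrightarrow> 1 - success_upto n \<rho> (h (Some \<rho>)) = (1 / 2) ^ Suc n"
proof (induction n arbitrary: \<rho>)
  case 0
  show ?case by (simp add: emit_on_track card_UNIV_bool card_cartesian_product
      flip: UNIV_Times_UNIV)
next
  case (Suc n)
  obtain a where a: "emit \<rho> = return_pmf a"
    and det: "\<And>s. deterministic (transition \<rho> (s, a))"
    using deterministicD[OF Suc.prems] by blast
  have pmf_env: "pmf (emit (h (Some \<rho>))) (s, False) = 1 / (2 * CARD('s))" for s
    by (simp add: emit_on_track card_cartesian_product flip: UNIV_Times_UNIV)
  \<comment> \<open>Only the forced action \<open>a\<close> contributes; summing over the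
    \<open>CARD('s)\<close> observations then leaves the factor 1/2.\<close>
  have step: "pmf (emit \<rho>) b * pmf (emit (h (Some \<rho>))) (s, False) *
      (1 - success_upto n (transition \<rho> (s, b)) (transition (h (Some \<rho>)) (b, (s, False)))) =
      (if b = a then 1 / (2 * CARD('s)) * (1 / 2) ^ Suc n else 0)" for s b
  proof (cases "b = a")
    case True
    with Suc.IH[OF det, of s] show ?thesis
      by (simp only: pmf_env transition_on_track a if_True pmf_return mult_1_left refl) simp
  qed (simp add: a)
  show ?case
    unfolding one_minus_success_upto_Suc step by (simp add: sum.delta)
qed

lemma success_on_track:
  assumes "deterministic \<rho>"
  shows "success \<rho> (h (Some \<rho>)) = 1"
proof -
  have "(\<lambda>n. 1 - (1 / 2 :: real) ^ Suc n) \<longlonglongrightarrow> 1 - 0"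
    by (intro tendsto_intros LIMSEQ_Suc LIMSEQ_power_zero) simp
  moreover have "success_upto n \<rho> (h (Some \<rho>)) = 1 - (1 / 2) ^ Suc n" for n
    using one_minus_success_upto_on_track[OF assms, of n] by simp
  ultimately show ?thesis
    using success_upto_tendsto[of \<rho> "h (Some \<rho>)"] by (simp add: LIMSEQ_unique)
qed

text \<open>Almost sure success against the shadow of \<rho> is a bisimulation: it forces the action
  of \<rho> and passes to the successors under every observation.\<close>

lemma success_eq_1_imp_on_track:
  assumes "deterministic \<rho>" and "success \<pi> (h (Some \<rho>)) = 1"
  shows "\<pi> = \<rho>"
proof (rule transducer_coinduct
    [where R = "\<lambda>\<pi> \<rho>. deterministic \<rho> \<and> success \<pi> (h (Some \<rho>)) = 1"])
  show "deterministic \<rho> \<and> success \<pi> (h (Some \<rho>)) = 1"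
    using assms by blast
next
  fix \<pi> \<rho>
  assume R: "deterministic \<rho> \<and> success \<pi> (h (Some \<rho>)) = 1"
  obtain a where a: "emit \<rho> = return_pmf a"
    and det: "\<And>s. deterministic (transition \<rho> (s, a))"
    using deterministicD[OF conjunct1[OF R]] by blast
  \<comment> \<open>The uniform emission gives every \<open>(s, False)\<close> positive probability,
    so no observation escapes the test.\<close>
  have next_1: "success (transition \<pi> (s, b))
      (h (if b = a then Some (transition \<rho> (s, b)) else None)) = 1"
    if "b \<in> set_pmf (emit \<pi>)" for s b
    using success_transition_eq_1[OF _ that, of "h (Some \<rho>)" s] R
    by (simp add: emit_on_track transition_on_track a eq_commute[of a b])
  \<comment> \<open>Any other action would lead to \<open>h None\<close>, where the success
    probability is 0 instead of 1.\<close>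
  have "b = a" if "b \<in> set_pmf (emit \<pi>)" for b
    using next_1[OF that] success_losing_env[OF losing_off_track] by (metis zero_neq_one)
  then have "emit \<pi> = return_pmf a"
    by (simp add: set_pmf_subset_singleton[symmetric] subset_iff)
  then show "emit \<pi> = emit \<rho> \<and> (\<forall>s. \<forall>b \<in> set_pmf (emit \<pi>). deterministic (transition \<rho> (s, b)) \<and>
      success (transition \<pi> (s, b)) (h (Some (transition \<rho> (s, b)))) = 1)"
    using next_1[of a] a det by simp
qed

end

theorem theorem6p3p2:
  fixes \<pi> :: "('s::finite, 'a::finite) policy"
  assumes "deterministic \<pi>"
  shows "specifiable \<pi>"
proof -
  define p :: "('s, 'a) policy option \<Rightarrow> ('s \<times> bool) pmf" where
    "p = case_option (return_pmf (undefined, False)) (\<lambda>_. pmf_of_set UNIV)"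
  \<comment> \<open>Success and failure share a successor, since \<open>success_upto\<close> follows
    transitions only after \<open>False\<close>. \<open>None\<close> is absorbing, which makes
    \<open>h None\<close> losing.\<close>
  define f :: "('s, 'a) policy option \<Rightarrow> 'a \<times> 's \<times> bool \<Rightarrow> ('s, 'a) policy option" where
    "f x = (\<lambda>(a, s, g). case x of None \<Rightarrow> None
      | Some \<rho> \<Rightarrow> if emit \<rho> = return_pmf a then Some (transition \<rho> (s, a)) else None)" for x
  obtain h :: "('s, 'a) policy option \<Rightarrow> ('s, 'a) teleo_environment"
    where h: "\<forall>x. emit (h x) = p x \<and>
      (\<forall>a. \<forall>z \<in> set_pmf (p x). transition (h x) (a, z) = h (f x (a, z)))"
    using transducer_final[of p f] by blast
  \<comment> \<open>Full support turns the transition equation of \<open>h\<close>, stated on the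
    support, into an unconditional one.\<close>
  have on_track: "emit (h (Some \<rho>)) = pmf_of_set UNIV"
    "transition (h (Some \<rho>)) (a, (s, g)) =
      h (if emit \<rho> = return_pmf a then Some (transition \<rho> (s, a)) else None)" for \<rho> a s g
    using h[rule_format, of "Some \<rho>"] by (simp_all add: p_def f_def)
  have off_track: "losing_env (h None)"
    using h[rule_format, of None] by (simp add: p_def f_def losing_env_def)
  have "\<pi>' = \<pi>" if "success \<pi>' (h (Some \<pi>)) \<ge> success \<pi> (h (Some \<pi>))" for \<pi>'
  proof -
    have "success \<pi>' (h (Some \<pi>)) = 1"
      using that success_on_track[of h, OF on_track off_track assms]
        success_le_1[of \<pi>' "h (Some \<pi>)"] by simp
    then show ?thesis
      by (rule success_eq_1_imp_on_track[of h, OF on_track off_track assms])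
  qed
  then show ?thesis
    unfolding specifiable_def by blast
qed

end
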